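(* Let $n\ge1$ and let $\lambda=(\lambda_1\ge\dots\ge\lambda_n\ge0)$ be a partition. The sequence of Hall--Littlewood polynomials $\{P_{k\lambda}(\mathbf{x};t)\}_{k=1}^\infty$ in $\mathbf{x}=(x_1,\dots,x_n)$ satisfies a linear recurrence.
   Context: $k\lambda=(k\lambda_1,\dots,k\lambda_n)$. The Hall--Littlewood $P$ polynomials are $$P_\lambda(\mathbf{x};t)=\left(\prod_{i\ge0}\prod_{j=1}^{m_\lambda(i)}\frac{1-t}{1-t^j}\right)\sum_{\sigma\in S_n}\sigma\left(x_1^{\lambda_1}\cdots x_n^{\lambda_n}\prod_{i<j}\frac{x_i-tx_j}{x_i-x_j}\right),$$ where $m_\lambda(i)$ is the number of parts of $\lambda=(\lambda_1,\dots,\lambda_n)$ equal to $i$ (including $i=0$), and $\sigma$ acts on the indices of the variables. A sequence $\{a_k\}_{k\ge1}$ of polynomials satisfies a linear recurrence if there are $r\ge1$ and polynomials $c_1,\dots,c_r$ in the given variables, independent of $k$, such that $a_k+c_1a_{k-1}+\dots+c_ra_{k-r}=0$ for all $k\ge r+1$. *)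

theory Defs
  imports
    "HOL-Library.Poly_Mapping"
    "HOL-Computational_Algebra.Polynomial"
    "HOL-Computational_Algebra.Fraction_Field"
    "HOL-Combinatorics.Permutations"
begin

text \<open>
  Polynomials in \<open>x\<^sub>1, x\<^sub>2, \<dots>\<close> and \<open>t\<close> over \<open>'a\<close>: the outer layer maps an exponent vector in the
  \<open>x\<^sub>i\<close> to its coefficient, which is a univariate polynomial in \<open>t\<close>.
\<close>

type_synonym 'a xt_poly = "(nat \<Rightarrow>\<^sub>0 nat) \<Rightarrow>\<^sub>0 'a poly"

definition var_x :: "nat \<Rightarrow> 'a::comm_ring_1 xt_poly" where
  "var_x i = Poly_Mapping.single (Poly_Mapping.single i 1) 1"

definition var_t :: "'a::comm_ring_1 xt_poly" where
  "var_t = Poly_Mapping.single 0 [:0, 1:]"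

definition polys_in :: "nat \<Rightarrow> 'a::comm_ring_1 xt_poly set" where
  "polys_in n = {p. \<forall>m\<in>Poly_Mapping.keys p. Poly_Mapping.keys m \<subseteq> {1..n}}"

text \<open>A partition \<open>lam 1 \<ge> \<dots> \<ge> lam n \<ge> 0\<close> is a function whose values outside \<open>{1..n}\<close> are ignored.\<close>

definition is_partition :: "nat \<Rightarrow> (nat \<Rightarrow> nat) \<Rightarrow> bool" where
  "is_partition n lam \<longleftrightarrow> antimono_on {1..n} lam"

definition multiplicity_of_part :: "nat \<Rightarrow> (nat \<Rightarrow> nat) \<Rightarrow> nat \<Rightarrow> nat" where
  "multiplicity_of_part n lam i = card {j\<in>{1..n}. lam j = i}"

text \<open>
  The defining formula of the Hall--Littlewood polynomial, in the fraction field of the polynomial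
  ring. The outer product is restricted to the values \<open>i\<close> that occur as parts (possibly
  \<open>i = 0\<close>), since the inner product is empty for every other \<open>i\<close>.
\<close>

definition hall_littlewood_fract :: "nat \<Rightarrow> (nat \<Rightarrow> nat) \<Rightarrow> 'a::idom xt_poly fract" where
  "hall_littlewood_fract n lam =
     (\<Prod>i\<in>lam ` {1..n}. \<Prod>j=1..multiplicity_of_part n lam i. Fract (1 - var_t) (1 - var_t ^ j)) *
     (\<Sum>\<sigma> | \<sigma> permutes {1..n}.
        Fract (\<Prod>i=1..n. var_x (\<sigma> i) ^ lam i) 1 *
        (\<Prod>(i, j)\<in>{(i, j). 1 \<le> i \<and> i < j \<and> j \<le> n}.
           Fract (var_x (\<sigma> i) - var_t * var_x (\<sigma> j)) (var_x (\<sigma> i) - var_x (\<sigma> j))))"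

text \<open>
  The polynomial represented by that rational function; it is unique because \<open>p \<mapsto> p / 1\<close> is
  injective.
\<close>

definition hall_littlewood :: "nat \<Rightarrow> (nat \<Rightarrow> nat) \<Rightarrow> 'a::idom xt_poly" where
  "hall_littlewood n lam = (THE p. p \<in> polys_in n \<and> Fract p 1 = hall_littlewood_fract n lam)"

text \<open>The sequence is indexed from 1; the value at 0 is irrelevant.\<close>

definition satisfies_linear_recurrence :: "nat \<Rightarrow> (nat \<Rightarrow> 'a::comm_ring_1 xt_poly) \<Rightarrow> bool" where
  "satisfies_linear_recurrence n a \<longleftrightarrow>
     (\<exists>r\<ge>1. \<exists>c. (\<forall>i\<in>{1..r}. c i \<in> polys_in n) \<and>
       (\<forall>k\<ge>r + 1. a k + (\<Sum>i=1..r. c i * a (k - i)) = 0))"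

end

theory Submission
  imports
    Defs
    "HOL-Computational_Algebra.Polynomial_Factorial"
    "HOL-Combinatorics.Multiset_Permutations"
begin

text \<open>
  In the fraction field, \<open>P\<^bsub>k\<lambda>\<^esub>\<close> is \<open>\<Sum>\<sigma>. B\<^bsub>\<sigma>\<^esub> * y\<^bsub>\<sigma>\<^esub> ^ k\<close>, where \<open>y\<^bsub>\<sigma>\<^esub> = \<sigma> x\<^sup>\<lambda>\<close> and \<open>B\<^bsub>\<sigma>\<^esub>\<close> does not
  depend on \<open>k \<ge> 1\<close>. Hence the coefficients of \<open>\<Prod>\<sigma>. Z - y\<^bsub>\<sigma>\<^esub>\<close> give a recurrence.

  These fractions are polynomials for the following reason. The sum over \<open>S\<^sub>n\<close> is an
  antisymmetric polynomial divided by the Vandermonde product, hence a polynomial. Summing first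
  over the orderings of each block of equal parts extracts the normalising factor, a
  product of \<open>t\<close>-factorials, and leaves a fraction whose denominator is a product of differences
  \<open>x\<^sub>i - x\<^sub>j\<close>. No \<open>x\<^sub>i - x\<^sub>j\<close> shares a factor with a polynomial in \<open>t\<close>, so the factor divides
  the sum.
\<close>

subsection \<open>Renaming variables\<close>

text \<open>One definition serves twice: it moves exponents along a map of variables, and
  coefficients along the resulting map of monomials. Values in a fibre are added, so
  \<open>e\<close> may identify points.\<close>

definition push :: "('b \<Rightarrow> 'd) \<Rightarrow> ('b \<Rightarrow>\<^sub>0 'c::comm_monoid_add) \<Rightarrow> 'd \<Rightarrow>\<^sub>0 'c" where
  "push e p = (\<Sum>m\<in>Poly_Mapping.keys p. Poly_Mapping.single (e m) (Poly_Mapping.lookup p m))"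

lemma push_zero [simp]: "push e 0 = 0"
  by (simp add: push_def)

lemma push_add: "push e (p + q) = push e p + push e q"
  unfolding push_def by (rule setsum_keys_plus_distrib) (simp_all add: single_add)

lemma push_single [simp]: "push e (Poly_Mapping.single m c) = Poly_Mapping.single (e m) c"
  by (cases "c = 0") (simp_all add: push_def)

lemma poly_mapping_single_induct [case_names zero add]:
  assumes "P 0" "\<And>m c p. P p \<Longrightarrow> P (Poly_Mapping.single m c + p)"
  shows "P (p :: 'b \<Rightarrow>\<^sub>0 'c::comm_monoid_add)"
proof -
  have eq: "p = (\<Sum>m\<in>Poly_Mapping.keys p. Poly_Mapping.single m (Poly_Mapping.lookup p m))"
    by (rule poly_mapping_eqI)
      (auto simp: lookup_sum lookup_single when_def sum.delta in_keys_iff)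
  have "P (\<Sum>m\<in>A. Poly_Mapping.single m (Poly_Mapping.lookup p m))" if "finite A" for A
    using that by (induction A) (auto intro: assms)
  with eq show ?thesis
    by (metis finite_keys)
qed

lemma push_push: "push e (push h p) = push (e \<circ> h) p"
  by (induction p rule: poly_mapping_single_induct) (simp_all add: push_add)

text \<open>Both sides are additive in \<open>p\<close> and in \<open>q\<close>; on two single terms
  the claim is the additivity of \<open>e\<close>.\<close>

lemma push_mult:
  fixes p q :: "'b::monoid_add \<Rightarrow>\<^sub>0 'c::semiring_0"
  assumes e: "\<And>a b. e (a + b) = e a + (e b :: 'd::monoid_add)"
  shows "push e (p * q) = push e p * push e q"
proof (induction p rule: poly_mapping_single_induct)
  case (add m c p)
  have "push e (Poly_Mapping.single m c * q) = Poly_Mapping.single (e m) c * push e q"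
    by (induction q rule: poly_mapping_single_induct)
      (simp_all add: push_add distrib_left mult_single e)
  with add show ?case
    by (simp add: push_add distrib_right)
qed simp

lemma push_uminus: "push e (- p) = - push e (p :: 'b \<Rightarrow>\<^sub>0 'c::ab_group_add)"
  by (metis add_eq_0_iff push_add push_zero)

lemma push_id: "(\<And>m. m \<in> Poly_Mapping.keys p \<Longrightarrow> e m = m) \<Longrightarrow> push e p = p"
proof -
  assume "\<And>m. m \<in> Poly_Mapping.keys p \<Longrightarrow> e m = m"
  then have "push e p = push id p"
    by (simp add: push_def)
  also have "push id p = p"
    by (induction p rule: poly_mapping_single_induct) (simp_all add: push_add)
  finally show ?thesis .
qed

lemma keys_push: "Poly_Mapping.keys (push e p) \<subseteq> e ` Poly_Mapping.keys p"
proof -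
  have "Poly_Mapping.keys (push e p) \<subseteq>
    (\<Union>m\<in>Poly_Mapping.keys p. Poly_Mapping.keys (Poly_Mapping.single (e m) (Poly_Mapping.lookup p m)))"
    unfolding push_def by (rule Poly_Mapping.keys_sum)
  then show ?thesis by (auto split: if_splits)
qed

text \<open>The substitution of \<open>var_x (f i)\<close> for every \<open>var_x i\<close>, a ring
  homomorphism over the polynomials in \<open>t\<close>. As \<open>f\<close> is arbitrary, it covers
  permutations and identifications of variables and retractions onto fewer variables.\<close>

definition ren :: "(nat \<Rightarrow> nat) \<Rightarrow> 'a::comm_ring_1 xt_poly \<Rightarrow> 'a xt_poly" where
  "ren f = push (push f)"

lemma ren_zero [simp]: "ren f 0 = 0"
  and ren_add: "ren f (p + q) = ren f p + ren f q"
  and ren_uminus: "ren f (- p) = - ren f p"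
  and ren_mult: "ren f (p * q) = ren f p * ren f q"
  and ren_const [simp]: "ren f (Poly_Mapping.single 0 c) = Poly_Mapping.single 0 c"
  by (simp_all add: ren_def push_add push_uminus push_mult)

lemma ren_one [simp]: "ren f 1 = 1"
  using ren_const[of f 1] by simp

lemma ren_diff: "ren f (p - q) = ren f p - ren f q"
  using ren_add[of f p "- q"] by (simp add: ren_uminus)

lemma ren_power: "ren f (p ^ k) = ren f p ^ k"
  by (induction k) (simp_all add: ren_mult)

lemma ren_sum: "ren f (sum h A) = (\<Sum>a\<in>A. ren f (h a))"
  by (induction A rule: infinite_finite_induct) (simp_all add: ren_add)

lemma ren_prod: "ren f (prod h A) = (\<Prod>a\<in>A. ren f (h a))"
  by (induction A rule: infinite_finite_induct) (simp_all add: ren_mult)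

lemma ren_var_x [simp]: "ren f (var_x i) = var_x (f i)"
  by (simp add: ren_def var_x_def)

lemma ren_var_t [simp]: "ren f var_t = var_t"
  by (simp add: var_t_def)

lemma ren_ren: "ren f (ren g p) = ren (f \<circ> g) p"
proof -
  have "push f \<circ> push g = (push (f \<circ> g) :: (nat \<Rightarrow>\<^sub>0 nat) \<Rightarrow> _)"
    by (simp add: fun_eq_iff push_push)
  then show ?thesis by (simp add: ren_def push_push)
qed

lemma xt_poly_induct [case_names const var add mult]:
  assumes "\<And>c. P (Poly_Mapping.single 0 c)" "\<And>i. P (var_x i)"
    "\<And>p q. P p \<Longrightarrow> P q \<Longrightarrow> P (p + q)" "\<And>p q. P p \<Longrightarrow> P q \<Longrightarrow> P (p * q)"
  shows "P (p :: 'a::comm_ring_1 xt_poly)"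
proof -
  have pow: "P (Poly_Mapping.single (Poly_Mapping.single i k) 1)" for i k
  proof (induction k)
    case 0
    then show ?case using assms(1)[of 1] by simp
  next
    case (Suc k)
    have "Poly_Mapping.single (Poly_Mapping.single i (Suc k)) (1 :: 'a poly) =
        var_x i * Poly_Mapping.single (Poly_Mapping.single i k) 1"
      by (simp add: var_x_def mult_single flip: single_add)
    then show ?case using assms(2,4) Suc by metis
  qed
  have mon: "P (Poly_Mapping.single m 1)" for m
  proof (induction m rule: poly_mapping_single_induct)
    case zero
    then show ?case using assms(1)[of 1] by simp
  next
    case (add i k m)
    have "Poly_Mapping.single (Poly_Mapping.single i k + m) (1 :: 'a poly) =
        Poly_Mapping.single (Poly_Mapping.single i k) 1 * Poly_Mapping.single m 1"
      by (simp add: mult_single)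
    then show ?case using assms(4) pow add by metis
  qed
  show ?thesis
  proof (induction p rule: poly_mapping_single_induct)
    case zero
    then show ?case using assms(1)[of 0] by simp
  next
    case (add m c p)
    have "Poly_Mapping.single m c = Poly_Mapping.single 0 c * Poly_Mapping.single m 1"
      by (simp add: mult_single)
    then show ?case using assms(1,3,4) mon add by metis
  qed
qed

section \<open>Identification of two variables and the factor theorem\<close>

definition collapse :: "nat \<Rightarrow> nat \<Rightarrow> nat \<Rightarrow> nat" where
  "collapse i j = id(i := j)"

text \<open>Modulo \<open>var_x i - var_x j\<close>, the renaming agrees with the identity on
  generators, hence everywhere; products use
  \<open>pq - p'q' = (p - p')q + p'(q - q')\<close>.\<close>

lemma diff_dvd_diff_ren_collapse:
  "var_x i - var_x j dvd p - ren (collapse i j) (p :: 'a::comm_ring_1 xt_poly)"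
proof (induction p rule: xt_poly_induct)
  case (var k)
  then show ?case by (simp add: collapse_def)
next
  case (add p q)
  then have "var_x i - var_x j dvd (p - ren (collapse i j) p) + (q - ren (collapse i j) q)"
    by (rule dvd_add)
  then show ?case by (simp add: ren_add algebra_simps)
next
  case (mult p q)
  then have "var_x i - var_x j dvd
    (p - ren (collapse i j) p) * q + ren (collapse i j) p * (q - ren (collapse i j) q)"
    by (intro dvd_add dvd_mult dvd_mult2)
  then show ?case by (simp add: ren_mult algebra_simps)
qed simp

lemma ren_collapse_eq_0_imp_dvd:
  "ren (collapse i j) p = 0 \<Longrightarrow> var_x i - var_x j dvd p"
  using diff_dvd_diff_ren_collapse[of i j p] by simp

lemma var_x_eq_iff [simp]: "(var_x i :: 'a::comm_ring_1 xt_poly) = var_x j \<longleftrightarrow> i = j"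
proof
  assume "(var_x i :: 'a xt_poly) = var_x j"
  then have "Poly_Mapping.keys (var_x i :: 'a xt_poly) = Poly_Mapping.keys (var_x j :: 'a xt_poly)"
    by simp
  then have "Poly_Mapping.single i (1::nat) = Poly_Mapping.single j 1"
    by (simp add: var_x_def)
  then have "Poly_Mapping.keys (Poly_Mapping.single i (1::nat)) = Poly_Mapping.keys (Poly_Mapping.single j (1::nat))"
    by simp
  then show "i = j" by simp
qed simp

lemma var_x_neq_0 [simp]: "(var_x i :: 'a::comm_ring_1 xt_poly) \<noteq> 0"
proof
  assume "(var_x i :: 'a xt_poly) = 0"
  then have "Poly_Mapping.keys (var_x i :: 'a xt_poly) = {}" by simp
  then show False by (simp add: var_x_def)
qed

section \<open>Polynomials in finitely many variables as fixed points of a renaming\<close>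

definition clamp :: "nat \<Rightarrow> nat \<Rightarrow> nat" where
  "clamp n i = (if i \<in> {1..n} then i else 1)"

text \<open>Membership becomes a fixed-point equation of a ring homomorphism, which passes to
  quotients in a domain. As \<open>n \<ge> 1\<close>, the default index 1 of \<open>clamp\<close>
  lies in \<open>{1..n}\<close>, so no other variable occurs in the image.\<close>

lemma polys_in_iff_ren:
  assumes "n \<ge> 1"
  shows "p \<in> polys_in n \<longleftrightarrow> ren (clamp n) p = p"
proof
  assume "p \<in> polys_in n"
  then show "ren (clamp n) p = p"
    unfolding ren_def polys_in_def
    by (intro push_id) (use \<open>p \<in> polys_in n\<close> in \<open>force simp: clamp_def polys_in_def\<close>)
next
  assume p: "ren (clamp n) p = p"
  have "Poly_Mapping.keys m \<subseteq> {1..n}" if "m \<in> Poly_Mapping.keys (ren (clamp n) p)" for m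
  proof -
    from that keys_push[of "push (clamp n)" p] obtain m' where "m = push (clamp n) m'"
      by (auto simp: ren_def)
    with keys_push[of "clamp n" m'] assms show ?thesis
      by (auto simp: clamp_def)
  qed
  with p show "p \<in> polys_in n"
    by (auto simp: polys_in_def)
qed

subsection \<open>The sum over all orderings of the variables\<close>

text \<open>The t-integer \<open>(1 - t^n) / (1 - t)\<close>, written without division so that it
  makes sense in the polynomial ring as well as in its fraction field.\<close>

definition q_int :: "'a::comm_semiring_1 \<Rightarrow> nat \<Rightarrow> 'a" where
  "q_int t n = (\<Sum>l<n. t ^ l)"

definition q_fact :: "'a::comm_semiring_1 \<Rightarrow> nat \<Rightarrow> 'a" where
  "q_fact t n = (\<Prod>j=1..n. q_int t j)"

lemma q_fact_0 [simp]: "q_fact t 0 = 1"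
  and q_fact_Suc: "q_fact t (Suc n) = q_fact t n * q_int t (Suc n)"
  by (simp_all add: q_fact_def prod.nat_ivl_Suc')

section \<open>Symmetrisation over a finite set of variables with values in a field\<close>

context
  fixes x :: "nat \<Rightarrow> 'k::field" and t :: 'k
begin

definition hl_factor :: "nat \<Rightarrow> nat \<Rightarrow> 'k" where
  "hl_factor a b = (x a - t * x b) / (x a - x b)"

text \<open>With equal exponents, the choice of the first variable contributes a t-integer, whatever
  the values of the variables; iterating this produces the t-factorials.\<close>

lemma sum_prod_hl_factor:
  assumes S: "finite S" "inj_on x S" "\<And>a. a \<in> S \<Longrightarrow> x a \<noteq> 0" and t: "t \<noteq> 1"
  shows "(\<Sum>a\<in>S. \<Prod>b\<in>S - {a}. hl_factor a b) = q_int t (card S)"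
proof (cases "S = {}")
  case True
  then show ?thesis by (simp add: q_int_def)
next
  case False
  \<comment> \<open>Lagrange interpolation of \<open>p = (\<Prod>j\<in>S. z - t * x j) - (\<Prod>j\<in>S. z - x j)\<close> at the nodes
    \<open>x a\<close>, evaluated at \<open>z = 0\<close>\<close>
  define G where "G y = (\<Prod>j\<in>S. [:- y j, 1:])" for y :: "nat \<Rightarrow> 'k"
  have G_deg: "Polynomial.degree (G y) = card S" and G_lead: "lead_coeff (G y) = 1" for y
  proof -
    show "Polynomial.degree (G y) = card S"
      unfolding G_def by (subst degree_prod_eq_sum_degree) auto
    show "lead_coeff (G y) = 1"
      unfolding G_def by (subst lead_coeff_prod) auto
  qed
  define p where "p = G (\<lambda>j. t * x j) - G x"
  define q where "q = (\<Sum>a\<in>S. smult (poly p (x a) / (\<Prod>b\<in>S - {a}. x a - x b))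
    (\<Prod>b\<in>S - {a}. [:- x b, 1:]))"
  have "card S > 0"
    using S(1) False by (simp add: card_gt_0_iff)
  \<comment> \<open>Both products are monic, so the leading terms cancel and \<open>card S\<close>
    nodes determine \<open>p\<close>.\<close>
  have "Polynomial.degree p \<le> card S"
    unfolding p_def by (rule degree_diff_le) (simp_all add: G_deg)
  moreover have "coeff p (card S) = 0"
    using G_lead[of x] G_lead[of "\<lambda>j. t * x j"] by (simp add: p_def G_deg)
  ultimately have "Polynomial.degree p < card S"
    using eq_zero_or_degree_less[of p "card S"] \<open>card S > 0\<close> by auto
  moreover have "Polynomial.degree q < card S"
  proof -
    have "Polynomial.degree (smult c (\<Prod>b\<in>S - {a}. [:- x b, 1:])) < card S" if "a \<in> S" for a c
    proof -
      have "Polynomial.degree (\<Prod>b\<in>S - {a}. [:- x b, 1:]) = card (S - {a})"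
        by (subst degree_prod_eq_sum_degree) auto
      then show ?thesis
        using that S(1) \<open>card S > 0\<close> degree_smult_le[of c "\<Prod>b\<in>S - {a}. [:- x b, 1:]"]
        by simp
    qed
    then show ?thesis
      unfolding q_def using \<open>card S > 0\<close>
      by (intro degree_sum_less) (auto simp del: degree_smult_eq)
  qed
  moreover have "poly q (x c) = poly p (x c)" if "c \<in> S" for c
  proof -
    have 0: "(\<Prod>b\<in>S - {a}. x c - x b) = 0" if "a \<in> S - {c}" for a
      using that \<open>c \<in> S\<close> S(1) by (intro prod_zero) auto
    have "poly q (x c) = (\<Sum>a\<in>S. poly p (x a) / (\<Prod>b\<in>S - {a}. x a - x b) * (\<Prod>b\<in>S - {a}. x c - x b))"
      by (simp add: q_def poly_sum poly_prod)
    also have "\<dots> = poly p (x c) / (\<Prod>b\<in>S - {c}. x c - x b) * (\<Prod>b\<in>S - {c}. x c - x b)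
       + (\<Sum>a\<in>S - {c}. poly p (x a) / (\<Prod>b\<in>S - {a}. x a - x b) * (\<Prod>b\<in>S - {a}. x c - x b))"
      using that S(1) by (simp add: sum.remove)
    also have "(\<Sum>a\<in>S - {c}. poly p (x a) / (\<Prod>b\<in>S - {a}. x a - x b) * (\<Prod>b\<in>S - {a}. x c - x b)) = 0"
      using 0 by (intro sum.neutral) auto
    also have "(\<Prod>b\<in>S - {c}. x c - x b) \<noteq> 0"
      using that S(1,2) by (auto dest: inj_onD)
    ultimately show ?thesis by simp
  qed
  moreover have "card (x ` S) = card S"
    by (rule card_image) fact
  ultimately have "p = q"
    by (intro poly_eqI_degree[of "x ` S"]) auto
  have x0: "(\<Prod>j\<in>S. - x j) \<noteq> 0"
    using S by simp
  have "(t ^ card S - 1) * (\<Prod>j\<in>S. - x j) = poly p 0"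
  proof -
    have "(\<Prod>j\<in>S. - (t * x j)) = t ^ card S * (\<Prod>j\<in>S. - x j)"
      by (simp only: prod_constant[symmetric] prod.distrib[symmetric] mult_minus_right)
    then show ?thesis
      by (simp add: p_def G_def poly_prod left_diff_distrib)
  qed
  also have "\<dots> = (\<Sum>a\<in>S. (1 - t) * x a * (\<Prod>b\<in>S - {a}. hl_factor a b) * (\<Prod>b\<in>S - {a}. - x b))"
    unfolding \<open>p = q\<close>
  proof (unfold q_def poly_sum, rule sum.cong, goal_cases)
    case (2 a)
    \<comment> \<open>At the node \<open>x a\<close> the second product vanishes, and the factor of
      the first with \<open>j = a\<close> is \<open>(1 - t) * x a\<close>.\<close>
    have "poly (G x) (x a) = 0"
      unfolding G_def poly_prod using 2 S(1) by (intro prod_zero) auto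
    then have "poly p (x a) = (\<Prod>j\<in>S. x a - t * x j)"
      by (simp add: p_def G_def poly_prod)
    also have "\<dots> = (1 - t) * x a * (\<Prod>b\<in>S - {a}. x a - t * x b)"
      using 2 S(1) by (simp add: prod.remove algebra_simps)
    finally show ?case
      by (simp add: poly_prod hl_factor_def prod_dividef)
  qed simp
  also have "\<dots> = (\<Sum>a\<in>S. - (1 - t) * (\<Prod>j\<in>S. - x j) * (\<Prod>b\<in>S - {a}. hl_factor a b))"
  proof (rule sum.cong, goal_cases)
    case (2 a)
    then have "(\<Prod>j\<in>S. - x j) = - x a * (\<Prod>b\<in>S - {a}. - x b)"
      using S(1) by (simp add: prod.remove)
    then show ?case by (simp add: algebra_simps)
  qed simp
  also have "\<dots> = - (1 - t) * (\<Prod>j\<in>S. - x j) * (\<Sum>a\<in>S. \<Prod>b\<in>S - {a}. hl_factor a b)"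
    by (simp add: sum_distrib_left)
  finally have "(t ^ card S - 1) * (\<Prod>j\<in>S. - x j) =
      (- (1 - t) * (\<Sum>a\<in>S. \<Prod>b\<in>S - {a}. hl_factor a b)) * (\<Prod>j\<in>S. - x j)"
    by (simp only: mult_ac)
  then have "t ^ card S - 1 = - (1 - t) * (\<Sum>a\<in>S. \<Prod>b\<in>S - {a}. hl_factor a b)"
    by (rule mult_right_cancel[OF x0, THEN iffD1])
  then have "(1 - t) * (\<Sum>a\<in>S. \<Prod>b\<in>S - {a}. hl_factor a b) = 1 - t ^ card S"
    by (simp only: mult_minus_left flip: minus_diff_eq[of "t ^ card S"]) (simp only: minus_minus)
  also have "\<dots> = (1 - t) * q_int t (card S)"
    by (simp add: one_diff_power_eq q_int_def)
  finally show ?thesis using t by simp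
qed

text \<open>The recursion chooses the variable that receives the first exponent. If
  \<open>length ls = card S\<close>, this is the sum over all orderings of \<open>S\<close>, in a
  form from which leading exponents can be split off.\<close>

primrec hl_sum :: "nat list \<Rightarrow> nat set \<Rightarrow> 'k" where
  "hl_sum [] S = 1"
| "hl_sum (c # ls) S = (\<Sum>a\<in>S. x a ^ c * (\<Prod>b\<in>S - {a}. hl_factor a b) * hl_sum ls (S - {a}))"

text \<open>Orderings are grouped by the set \<open>I\<close> of variables in the leading block of
  equal exponents. The factors between \<open>I\<close> and the rest depend on \<open>I\<close>
  alone; those inside \<open>I\<close> sum to a t-factorial, one t-integer per induction
  step.\<close>

lemma hl_sum_block:
  assumes "finite S" "inj_on x S" "\<And>a. a \<in> S \<Longrightarrow> x a \<noteq> 0" "t \<noteq> 1"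
  shows "hl_sum (replicate m c @ ls) S = q_fact t m *
    (\<Sum>I | I \<subseteq> S \<and> card I = m. (\<Prod>i\<in>I. x i ^ c * (\<Prod>j\<in>S - I. hl_factor i j)) * hl_sum ls (S - I))"
  using assms(1-3)
proof (induction m arbitrary: S)
  case 0
  then have "{I. I \<subseteq> S \<and> card I = 0} = {{}}"
    by (auto simp: card_eq_0_iff dest: finite_subset)
  then show ?case by simp
next
  case (Suc m)
  define F where "F S I = (\<Prod>i\<in>I. x i ^ c * (\<Prod>j\<in>S - I. hl_factor i j)) * hl_sum ls (S - I)"
    for S I
  \<comment> \<open>The factors of \<open>a\<close> split into those inside the block and those
    leaving it; the latter, with \<open>x a ^ c\<close>, complete \<open>F (S - {a}) J\<close> to
    \<open>F S (insert a J)\<close>.\<close>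
  have step: "x a ^ c * (\<Prod>b\<in>S - {a}. hl_factor a b) * F (S - {a}) J =
      F S (insert a J) * (\<Prod>b\<in>insert a J - {a}. hl_factor a b)"
    if "a \<in> S" "J \<subseteq> S - {a}" for a J
  proof -
    have fin: "finite J" "a \<notin> J" using that Suc.prems(1) by (auto dest: finite_subset)
    have "S - {a} = J \<union> (S - insert a J)" using that by auto
    then have "(\<Prod>b\<in>S - {a}. hl_factor a b) = (\<Prod>b\<in>J. hl_factor a b) * (\<Prod>b\<in>S - insert a J. hl_factor a b)"
      using fin Suc.prems(1) by (metis Diff_disjoint finite_Diff prod.union_disjoint Diff_insert2 Int_Diff)
    moreover have "S - {a} - J = S - insert a J" by auto
    ultimately show ?thesis
      using fin by (simp add: F_def)
  qed
  have "hl_sum (replicate (Suc m) c @ ls) S =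
    (\<Sum>a\<in>S. x a ^ c * (\<Prod>b\<in>S - {a}. hl_factor a b) *
       (q_fact t m * (\<Sum>J | J \<subseteq> S - {a} \<and> card J = m. F (S - {a}) J)))"
  proof -
    have "hl_sum (replicate m c @ ls) (S - {a}) =
        q_fact t m * (\<Sum>J | J \<subseteq> S - {a} \<and> card J = m. F (S - {a}) J)" for a
      unfolding F_def using Suc.prems by (intro Suc.IH) (auto simp: inj_on_diff)
    then show ?thesis by simp
  qed
  also have "\<dots> = q_fact t m * (\<Sum>a\<in>S. \<Sum>J | J \<subseteq> S - {a} \<and> card J = m.
      F S (insert a J) * (\<Prod>b\<in>insert a J - {a}. hl_factor a b))"
    unfolding sum_distrib_left
    by (intro sum.cong refl) (use step in \<open>simp add: mult_ac\<close>)
  also have "(\<Sum>a\<in>S. \<Sum>J | J \<subseteq> S - {a} \<and> card J = m.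
      F S (insert a J) * (\<Prod>b\<in>insert a J - {a}. hl_factor a b)) =
    (\<Sum>(a, J)\<in>(SIGMA a:S. {J. J \<subseteq> S - {a} \<and> card J = m}).
      F S (insert a J) * (\<Prod>b\<in>insert a J - {a}. hl_factor a b))"
    using Suc.prems(1) by (intro sum.Sigma) auto
  \<comment> \<open>Double counting: the block \<open>I = insert a J\<close> is chosen first and its
    first variable \<open>a\<close> afterwards.\<close>
  also have "\<dots> = (\<Sum>(I, a)\<in>(SIGMA I:{I. I \<subseteq> S \<and> card I = Suc m}. I).
      F S I * (\<Prod>b\<in>I - {a}. hl_factor a b))"
  proof -
    have fin: "finite J" if "J \<subseteq> S" for J using that Suc.prems(1) by (rule finite_subset)
    have *: "card (insert a J) = Suc (card J)" if "J \<subseteq> S - {a}" for a J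
      using that fin[of J] by (intro card_insert_disjoint) auto
    show ?thesis
      by (rule sum.reindex_bij_witness[of _ "\<lambda>(I, a). (a, I - {a})" "\<lambda>(a, J). (insert a J, a)"])
        (auto simp: * insert_absorb)
  qed
  also have "\<dots> = (\<Sum>I | I \<subseteq> S \<and> card I = Suc m. \<Sum>a\<in>I. F S I * (\<Prod>b\<in>I - {a}. hl_factor a b))"
    using Suc.prems(1) by (intro sum.Sigma[symmetric]) (auto dest: finite_subset)
  also have "\<dots> = (\<Sum>I | I \<subseteq> S \<and> card I = Suc m. q_int t (Suc m) * F S I)"
  proof (intro sum.cong refl)
    fix I assume "I \<in> {I. I \<subseteq> S \<and> card I = Suc m}"
    then have "(\<Sum>a\<in>I. \<Prod>b\<in>I - {a}. hl_factor a b) = q_int t (Suc m)"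
      using Suc.prems assms(4) by (subst sum_prod_hl_factor) (auto dest: finite_subset inj_on_subset)
    then show "(\<Sum>a\<in>I. F S I * (\<Prod>b\<in>I - {a}. hl_factor a b)) = q_int t (Suc m) * F S I"
      by (simp flip: sum_distrib_left)
  qed
  finally show ?case
    by (simp add: q_fact_Suc F_def sum_distrib_left mult_ac)
qed

section \<open>Orderings as lists, and their translation to permutations\<close>

definition hl_weight :: "nat list \<Rightarrow> nat list \<Rightarrow> 'k" where
  "hl_weight ls xs = (\<Prod>i<length ls. x (xs ! i) ^ (ls ! i)) *
    (\<Prod>i<length ls. \<Prod>j\<in>{i<..<length ls}. hl_factor (xs ! i) (xs ! j))"

lemma hl_weight_Cons:
  assumes "length xs = length ls" "distinct xs"
  shows "hl_weight (c # ls) (a # xs) =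
    x a ^ c * (\<Prod>b\<in>set xs. hl_factor a b) * hl_weight ls xs"
proof -
  have "k \<in> Suc ` A \<longleftrightarrow> k \<noteq> 0 \<and> k - 1 \<in> A" for k A
    by (cases k) auto
  then have 1: "{0<..<Suc n} = Suc ` {..<n}" "{Suc i<..<Suc n} = Suc ` {i<..<n}" for n i :: nat
    by (intro set_eqI; simp; linarith)+
  have "(\<Prod>j<length ls. hl_factor a (xs ! j)) = (\<Prod>b\<in>set xs. hl_factor a b)"
    using assms by (intro prod.reindex_bij_betw bij_betw_nth) auto
  then show ?thesis
    by (simp add: hl_weight_def prod.lessThan_Suc_shift 1 prod.reindex del: prod.lessThan_Suc)
qed

text \<open>Splitting the orderings of \<open>S\<close> by their first entry gives the recursion of
  \<open>hl_sum\<close>.\<close>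

lemma sum_hl_weight_permutations:
  assumes "finite S" "card S = length ls"
  shows "(\<Sum>xs\<in>permutations_of_set S. hl_weight ls xs) = hl_sum ls S"
  using assms
proof (induction ls arbitrary: S)
  case Nil
  then show ?case by (simp add: hl_weight_def)
next
  case (Cons c ls)
  have "S \<noteq> {}" using Cons.prems(2) by auto
  have "(\<Sum>xs\<in>permutations_of_set S. hl_weight (c # ls) xs) =
    (\<Sum>a\<in>S. \<Sum>xs\<in>(#) a ` permutations_of_set (S - {a}). hl_weight (c # ls) xs)"
    unfolding permutations_of_set_nonempty[OF \<open>S \<noteq> {}\<close>]
    using Cons.prems by (intro sum.UNION_disjoint) auto
  also have "\<dots> = (\<Sum>a\<in>S. \<Sum>xs\<in>permutations_of_set (S - {a}).
      x a ^ c * (\<Prod>b\<in>S - {a}. hl_factor a b) * hl_weight ls xs)"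
  proof (rule sum.cong[OF refl])
    fix a assume "a \<in> S"
    have "(\<Sum>xs\<in>(#) a ` permutations_of_set (S - {a}). hl_weight (c # ls) xs) =
      (\<Sum>xs\<in>permutations_of_set (S - {a}). hl_weight (c # ls) (a # xs))"
      by (subst sum.reindex) auto
    also have "\<dots> = (\<Sum>xs\<in>permutations_of_set (S - {a}).
      x a ^ c * (\<Prod>b\<in>S - {a}. hl_factor a b) * hl_weight ls xs)"
    proof (intro sum.cong refl)
      fix xs assume xs: "xs \<in> permutations_of_set (S - {a})"
      then have "set xs = S - {a}" "distinct xs" "length xs = length ls"
        using \<open>a \<in> S\<close> Cons.prems length_finite_permutations_of_set[OF xs]
        by (auto dest: permutations_of_setD)
      then show "hl_weight (c # ls) (a # xs) =
          x a ^ c * (\<Prod>b\<in>S - {a}. hl_factor a b) * hl_weight ls xs"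
        by (simp add: hl_weight_Cons)
    qed
    finally show "(\<Sum>xs\<in>(#) a ` permutations_of_set (S - {a}). hl_weight (c # ls) xs) =
      (\<Sum>xs\<in>permutations_of_set (S - {a}).
      x a ^ c * (\<Prod>b\<in>S - {a}. hl_factor a b) * hl_weight ls xs)" .
  qed
  also have "\<dots> = hl_sum (c # ls) S"
    using Cons.prems by (simp add: Cons.IH flip: sum_distrib_left)
  finally show ?case .
qed

text \<open>A permutation \<open>\<sigma>\<close> corresponds to the list of its values at 1, ...,
  n; this turns the defining sum into a sum over orderings.\<close>

lemma sum_permutes_eq_hl_sum:
  "(\<Sum>\<sigma> | \<sigma> permutes {1..n}. (\<Prod>i=1..n. x (\<sigma> i) ^ lam i) *
      (\<Prod>(i, j)\<in>{(i, j). 1 \<le> i \<and> i < j \<and> j \<le> n}. hl_factor (\<sigma> i) (\<sigma> j))) =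
    hl_sum (map lam [1..<Suc n]) {1..n}"
proof -
  define ns where "ns = [1..<Suc n]"
  have ns: "set ns = {1..n}" "distinct ns" "length ns = n" "\<And>i. i < n \<Longrightarrow> ns ! i = Suc i"
    by (auto simp: ns_def simp del: upt_Suc)
  have inj: "inj_on (\<lambda>\<sigma>. map \<sigma> ns) {\<sigma>. \<sigma> permutes {1..n}}"
  proof (rule inj_onI)
    fix \<sigma> \<tau> assume "\<sigma> \<in> {\<sigma>. \<sigma> permutes {1..n}}" "\<tau> \<in> {\<sigma>. \<sigma> permutes {1..n}}"
      and eq: "map \<sigma> ns = map \<tau> ns"
    then have p: "\<sigma> permutes {1..n}" "\<tau> permutes {1..n}" by auto
    show "\<sigma> = \<tau>"
    proof
      fix i show "\<sigma> i = \<tau> i"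
        using eq p ns(1) by (cases "i \<in> {1..n}") (auto simp: permutes_not_in)
    qed
  qed
  have "(\<lambda>\<sigma>. map \<sigma> ns) ` {\<sigma>. \<sigma> permutes {1..n}} = permutations_of_set {1..n}"
  proof (rule card_subset_eq)
    show "(\<lambda>\<sigma>. map \<sigma> ns) ` {\<sigma>. \<sigma> permutes {1..n}} \<subseteq> permutations_of_set {1..n}"
    proof (rule image_subsetI)
      fix \<sigma> assume "\<sigma> \<in> {\<sigma>. \<sigma> permutes {1..n}}"
      then have p: "\<sigma> permutes {1..n}" by simp
      show "map \<sigma> ns \<in> permutations_of_set {1..n}"
        using permutes_image[OF p] permutes_inj_on[OF p] ns(1,2)
        by (intro permutations_of_setI) (simp_all only: set_map distinct_map ns(1))
    qed
    show "card ((\<lambda>\<sigma>. map \<sigma> ns) ` {\<sigma>. \<sigma> permutes {1..n}}) = card (permutations_of_set {1..n})"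
      unfolding card_image[OF inj] by (simp add: card_permutations[OF refl])
  qed simp
  then have "(\<Sum>xs\<in>permutations_of_set {1..n}. hl_weight (map lam ns) xs) =
      (\<Sum>\<sigma> | \<sigma> permutes {1..n}. hl_weight (map lam ns) (map \<sigma> ns))"
    using sum.reindex[OF inj, of "hl_weight (map lam ns)"] by (simp add: o_def)
  moreover have "(\<Sum>xs\<in>permutations_of_set {1..n}. hl_weight (map lam ns) xs) = hl_sum (map lam ns) {1..n}"
    by (rule sum_hl_weight_permutations) (simp_all add: ns(3))
  ultimately have "hl_sum (map lam ns) {1..n} =
      (\<Sum>\<sigma> | \<sigma> permutes {1..n}. hl_weight (map lam ns) (map \<sigma> ns))"
    by simp
  also have "\<dots> = (\<Sum>\<sigma> | \<sigma> permutes {1..n}. (\<Prod>i=1..n. x (\<sigma> i) ^ lam i) *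
      (\<Prod>(i, j)\<in>{(i, j). 1 \<le> i \<and> i < j \<and> j \<le> n}. hl_factor (\<sigma> i) (\<sigma> j)))"
  proof (intro sum.cong refl)
    fix \<sigma> :: "nat \<Rightarrow> nat"
    \<comment> \<open>List positions start at 0, variables and parts at 1, hence the shifts by one
      here and below.\<close>
    have 1: "(\<Prod>i<n. x (map \<sigma> ns ! i) ^ (map lam ns ! i)) = (\<Prod>i=1..n. x (\<sigma> i) ^ lam i)"
      by (rule prod.reindex_bij_witness[of _ "\<lambda>i. i - 1" Suc]) (auto simp: ns(3,4))
    have "(\<Prod>i<n. \<Prod>j\<in>{i<..<n}. hl_factor (map \<sigma> ns ! i) (map \<sigma> ns ! j)) =
      (\<Prod>(i, j)\<in>(SIGMA i:{..<n}. {i<..<n}). hl_factor (map \<sigma> ns ! i) (map \<sigma> ns ! j))"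
      by (rule prod.Sigma) auto
    also have "\<dots> = (\<Prod>(i, j)\<in>{(i, j). 1 \<le> i \<and> i < j \<and> j \<le> n}. hl_factor (\<sigma> i) (\<sigma> j))"
      by (rule prod.reindex_bij_witness[of _ "\<lambda>(i, j). (i - 1, j - 1)" "\<lambda>(i, j). (Suc i, Suc j)"])
        (auto simp: ns(3,4))
    finally show "hl_weight (map lam ns) (map \<sigma> ns) = (\<Prod>i=1..n. x (\<sigma> i) ^ lam i) *
      (\<Prod>(i, j)\<in>{(i, j). 1 \<le> i \<and> i < j \<and> j \<le> n}. hl_factor (\<sigma> i) (\<sigma> j))"
      using 1 by (simp add: hl_weight_def ns(3))
  qed
  finally show ?thesis by (simp add: ns_def)
qed

end

subsection \<open>Polynomials in \<open>t\<close>\<close>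

lemma ren_of_int [simp]: "ren f (of_int k) = of_int k"
  using ren_const[of f "of_int k"] by simp

lemma ren_q_int [simp]: "ren f (q_int var_t n) = q_int var_t n"
  by (simp add: q_int_def ren_sum ren_power)

lemma ren_q_fact [simp]: "ren f (q_fact var_t n) = q_fact var_t n"
  by (simp add: q_fact_def ren_prod)

text \<open>The constant coefficient in \<open>t\<close> of the power is 0. Hence
  \<open>1 - t^j\<close> is nonzero and may serve as a denominator.\<close>

lemma var_t_power_neq_1: "j > 0 \<Longrightarrow> (var_t :: 'a::comm_ring_1 xt_poly) ^ j \<noteq> 1"
proof
  assume j: "j > 0" and "(var_t :: 'a xt_poly) ^ j = 1"
  have "(var_t :: 'a xt_poly) ^ j = Poly_Mapping.single 0 ([:0, 1:] ^ j)"
    unfolding var_t_def by (induction j) (simp_all add: mult_single)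
  with \<open>var_t ^ j = 1\<close> have "([:0, 1:] :: 'a poly) ^ j = 1"
    by (metis inj_single single_one injD lookup_single_eq)
  then have "coeff (([:0, 1:] :: 'a poly) ^ j) 0 = 1"
    by simp
  then show False
    using j by (simp add: coeff_0_power zero_power)
qed

lemma one_minus_var_t: "(1 - var_t) * q_int var_t j = 1 - (var_t :: 'a::comm_ring_1 xt_poly) ^ j"
  by (simp add: q_int_def one_diff_power_eq)

lemma q_int_var_t_neq_0: "j > 0 \<Longrightarrow> q_int (var_t :: 'a::idom xt_poly) j \<noteq> 0"
  by (metis mult_zero_right one_minus_var_t right_minus_eq var_t_power_neq_1)

lemma q_fact_var_t_neq_0: "q_fact (var_t :: 'a::idom xt_poly) m \<noteq> 0"
  by (simp add: q_fact_def q_int_var_t_neq_0)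

subsection \<open>The Vandermonde product\<close>

definition index_pairs :: "nat \<Rightarrow> (nat \<times> nat) set" where
  "index_pairs n = {(i, j). 1 \<le> i \<and> i < j \<and> j \<le> n}"

lemma finite_index_pairs [simp]: "finite (index_pairs n)"
  by (rule finite_subset[of _ "{1..n} \<times> {1..n}"]) (auto simp: index_pairs_def)

definition vandermonde :: "nat \<Rightarrow> 'a::comm_ring_1 xt_poly" where
  "vandermonde n = (\<Prod>(i, j)\<in>index_pairs n. var_x i - var_x j)"

lemma ren_prod_diff:
  "ren f (\<Prod>(i, j)\<in>A. var_x i - var_x j) = (\<Prod>(i, j)\<in>A. var_x (f i) - var_x (f j))"
  by (simp add: ren_prod ren_diff case_prod_beta)

text \<open>Among the forms \<open>var_x i - var_x j\<close> with \<open>i < j\<close>, only that of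
  \<open>(a, b)\<close> is killed by the identification. This plays the part of coprimality of
  distinct linear factors.\<close>

lemma ren_collapse_prod_diff_neq_0:
  assumes "A \<subseteq> index_pairs n" "(a, b) \<notin> A" "a < b"
  shows "ren (collapse a b) (\<Prod>(i, j)\<in>A. var_x i - var_x j :: 'a::idom xt_poly) \<noteq> 0"
proof -
  have "collapse a b i \<noteq> collapse a b j" if "(i, j) \<in> A" for i j
    using that assms by (auto simp: collapse_def index_pairs_def)
  moreover have "finite A"
    using assms(1) by (rule finite_subset) simp
  ultimately show ?thesis
    unfolding ren_prod_diff by (auto simp: prod_zero_iff)
qed

text \<open>Factors are divided out one by one: identifying the two variables of the next factor
  kills \<open>p\<close> but not the product \<open>D\<close> already removed, so it kills the
  cofactor.\<close>

lemma prod_diff_dvd: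
  assumes "A \<subseteq> index_pairs n"
    and "\<And>i j. (i, j) \<in> A \<Longrightarrow> ren (collapse i j) p = 0"
  shows "(\<Prod>(i, j)\<in>A. var_x i - var_x j) dvd (p :: 'a::idom xt_poly)"
proof -
  have "finite A" using assms(1) by (rule finite_subset) simp
  then show ?thesis using assms
  proof (induction A)
    case (insert e A)
    obtain a b where e: "e = (a, b)" by force
    define D where "D = (\<Prod>(i, j)\<in>A. var_x i - var_x j :: 'a xt_poly)"
    from insert have "D dvd p" by (simp add: D_def)
    then obtain q where q: "p = D * q" by auto
    have "ren (collapse a b) D \<noteq> 0"
      unfolding D_def
      by (rule ren_collapse_prod_diff_neq_0[of _ n]) (use insert e in \<open>auto simp: index_pairs_def\<close>)
    moreover have "ren (collapse a b) p = 0"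
      using insert.prems(2) e by simp
    ultimately have "ren (collapse a b) q = 0"
      by (simp add: q ren_mult)
    then have "var_x a - var_x b dvd q"
      by (rule ren_collapse_eq_0_imp_dvd)
    then have "(var_x a - var_x b) * D dvd p"
      by (simp add: q mult.commute)
    then show ?case
      using insert.hyps by (simp add: e D_def)
  qed simp
qed

lemma vandermonde_neq_0 [simp]: "vandermonde n \<noteq> (0 :: 'a::idom xt_poly)"
  unfolding vandermonde_def prod_zero_iff[OF finite_index_pairs] by (auto simp: index_pairs_def)

text \<open>
  The square of the product is invariant, so the product changes at most by a sign. The
  sign is detected by identifying \<open>x\<^sub>a\<close> with \<open>x\<^sub>b\<close> in the cofactor of \<open>x\<^sub>a - x\<^sub>b\<close>.
\<close>
lemma ren_transpose_vandermonde:
  assumes ab: "1 \<le> a" "a < b" "b \<le> n"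
  shows "ren (transpose a b) (vandermonde n) = - (vandermonde n :: 'a::{idom,ring_char_0} xt_poly)"
proof -
  let ?\<tau> = "transpose a b"
  have index_pair: "(a, b) \<in> index_pairs n"
    using ab by (simp add: index_pairs_def)
  \<comment> \<open>\<open>W\<close> reverses every factor. Then \<open>vandermonde n * W\<close>
    runs over all ordered pairs of distinct indices and is invariant, while \<open>W\<close> is the
    Vandermonde product up to sign.\<close>
  define W where "W = (\<Prod>(i, j)\<in>index_pairs n. var_x j - var_x i :: 'a xt_poly)"
  have "{(i, j). i \<in> {1..n} \<and> j \<in> {1..n} \<and> i \<noteq> j} = index_pairs n \<union> prod.swap ` index_pairs n"
    by (auto simp: index_pairs_def image_iff)
  moreover have "index_pairs n \<inter> prod.swap ` index_pairs n = {}"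
    by (auto simp: index_pairs_def)
  moreover have "W = (\<Prod>(i, j)\<in>prod.swap ` index_pairs n. var_x i - var_x j)"
    unfolding W_def by (subst prod.reindex) (auto simp: case_prod_beta)
  ultimately have VW: "vandermonde n * W =
      (\<Prod>(i, j)\<in>{(i, j). i \<in> {1..n} \<and> j \<in> {1..n} \<and> i \<noteq> j}. var_x i - var_x j)"
    unfolding vandermonde_def by (simp add: prod.union_disjoint)
  define f where "f = ?\<tau>"
  have f: "f k \<in> {1..n} \<longleftrightarrow> k \<in> {1..n}" "f (f k) = k" "f k = f l \<longleftrightarrow> k = l" for k l
    using ab by (auto simp: f_def transpose_def)
  have "ren f (vandermonde n * W) = vandermonde n * W"
    unfolding VW ren_prod_diff
    by (rule prod.reindex_bij_witness[of _ "\<lambda>(i, j). (f i, f j)" "\<lambda>(i, j). (f i, f j)"])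
      (auto simp: f simp del: atLeastAtMost_iff One_nat_def)
  then have "ren ?\<tau> (vandermonde n * W) = vandermonde n * W"
    by (simp only: f_def)
  moreover have W: "W = (- 1) ^ card (index_pairs n) * vandermonde n"
    unfolding W_def vandermonde_def prod_constant[symmetric] prod.distrib[symmetric]
    by (intro prod.cong) auto
  ultimately have "ren ?\<tau> (vandermonde n) ^ 2 = (vandermonde n ^ 2 :: 'a xt_poly)"
    by (simp add: ren_mult ren_power ren_uminus power2_eq_square)
  then consider "ren ?\<tau> (vandermonde n) = (vandermonde n :: 'a xt_poly)"
    | "ren ?\<tau> (vandermonde n) = - (vandermonde n :: 'a xt_poly)"
    by (auto simp: power2_eq_iff)
  then show ?thesis
  proof cases
    case 1
    define E where "E = (\<Prod>(i, j)\<in>index_pairs n - {(a, b)}. var_x i - var_x j :: 'a xt_poly)"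
    have V: "vandermonde n = (var_x a - var_x b) * E"
      unfolding vandermonde_def E_def
      using ab prod.remove[of "index_pairs n" "(a, b)" "\<lambda>(i, j). var_x i - var_x j"]
      by (simp add: index_pair)
    have "(var_x b - var_x a) * ren ?\<tau> E = (var_x a - var_x b) * E"
      using 1 by (simp add: V ren_mult ren_diff)
    then have "(var_x a - var_x b) * (- ren ?\<tau> E) = (var_x a - var_x b) * E"
      by (simp add: algebra_simps)
    moreover have "var_x a - var_x b \<noteq> (0 :: 'a xt_poly)"
      using ab by simp
    ultimately have "- ren ?\<tau> E = E"
      using mult_left_cancel by blast
    then have "ren ?\<tau> E = - E"
      by (metis minus_minus)
    then have "ren (collapse a b) (ren ?\<tau> E) = - ren (collapse a b) E"
      by (simp add: ren_uminus)
    \<comment> \<open>Swapping \<open>a\<close> and \<open>b\<close> has no effect once they are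
      identified. So the image of \<open>E\<close> is its own negative, hence 0 in characteristic 0,
      whereas no factor of \<open>E\<close> vanishes.\<close>
    moreover have "collapse a b \<circ> ?\<tau> = collapse a b"
      by (auto simp: fun_eq_iff collapse_def transpose_def)
    ultimately have "ren (collapse a b) E + ren (collapse a b) E = 0"
      by (simp add: ren_ren)
    then have "2 * ren (collapse a b) E = 0"
      by (simp only: mult_2)
    moreover have "ren (collapse a b) E \<noteq> 0"
      unfolding E_def by (rule ren_collapse_prod_diff_neq_0) (use ab in auto)
    ultimately show ?thesis by simp
  qed
qed

text \<open>Permutations are products of transpositions, each of which contributes a factor
  -1.\<close>

lemma ren_permutes_vandermonde:
  assumes "\<sigma> permutes {1..n}"
  shows "ren \<sigma> (vandermonde n) = of_int (sign \<sigma>) * (vandermonde n :: 'a::{idom,ring_char_0} xt_poly)"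
  using assms finite_atLeastAtMost[of 1 n]
proof (induction rule: permutes_induct)
  case id
  have "ren id p = p" for p :: "'a xt_poly"
    by (induction p rule: xt_poly_induct) (simp_all add: ren_add ren_mult)
  then show ?case by (simp only: sign_id of_int_1 mult_1)
next
  case (swap a b p)
  have "ren (transpose a b) (vandermonde n) = - (vandermonde n :: 'a xt_poly)"
    using swap ren_transpose_vandermonde[of a b n] ren_transpose_vandermonde[of b a n]
    by (cases a b rule: linorder_cases) (auto simp: transpose_commute)
  moreover have "sign (transpose a b \<circ> p) = - sign p"
    using swap by (subst sign_compose)
      (auto simp: sign_swap_id permutation_swap_id intro: permutes_imp_permutation[of "{1..n}"])
  moreover have "ren (transpose a b \<circ> p) (vandermonde n) =
      of_int (sign p) * ren (transpose a b) (vandermonde n :: 'a xt_poly)"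
    by (simp only: ren_ren[symmetric] swap ren_mult ren_of_int)
  ultimately show ?case
    by (simp only: of_int_minus mult_minus_left mult_minus_right)
qed

text \<open>Composing \<open>\<sigma>\<close> with a transposition reverses its sign but keeps its
  renamed polynomial once the two swapped variables are identified. The identified sum is therefore
  its own negative, hence 0.\<close>

lemma vandermonde_dvd_antisymmetrization:
  "vandermonde n dvd
    (\<Sum>\<sigma> | \<sigma> permutes {1..n}. of_int (sign \<sigma>) * ren \<sigma> (p :: 'a::{idom,ring_char_0} xt_poly))"
  (is "_ dvd ?N")
  unfolding vandermonde_def
proof (rule prod_diff_dvd[OF subset_refl])
  fix a b assume "(a, b) \<in> index_pairs n"
  then have ab: "a \<in> {1..n}" "b \<in> {1..n}" "a \<noteq> b"
    by (auto simp: index_pairs_def)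
  let ?\<tau> = "transpose a b" and ?c = "collapse a b"
  have \<tau>: "?\<tau> permutes {1..n}"
    using ab by (intro permutes_swap_id)
  have c: "?c \<circ> (?\<tau> \<circ> \<sigma>) = ?c \<circ> \<sigma>" for \<sigma> :: "nat \<Rightarrow> nat"
    by (auto simp: fun_eq_iff collapse_def transpose_def)
  have "ren ?c ?N = (\<Sum>\<sigma> | \<sigma> permutes {1..n}. of_int (sign \<sigma>) * ren (?c \<circ> \<sigma>) p)"
    by (simp add: ren_sum ren_mult ren_ren)
  also have "\<dots> = (\<Sum>\<sigma> | \<sigma> permutes {1..n}. of_int (sign (?\<tau> \<circ> \<sigma>)) * ren (?c \<circ> (?\<tau> \<circ> \<sigma>)) p)"
    by (rule setum_permutations_compose_left[OF \<tau>])
  also have "\<dots> = (\<Sum>\<sigma> | \<sigma> permutes {1..n}. - (of_int (sign \<sigma>) * ren (?c \<circ> \<sigma>) p))"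
  proof (rule sum.cong[OF refl])
    fix \<sigma> assume "\<sigma> \<in> {\<sigma>. \<sigma> permutes {1..n}}"
    then have "sign (?\<tau> \<circ> \<sigma>) = - sign \<sigma>"
      using ab by (subst sign_compose)
        (auto simp: sign_swap_id permutation_swap_id intro: permutes_imp_permutation[of "{1..n}"])
    then show "of_int (sign (?\<tau> \<circ> \<sigma>)) * ren (?c \<circ> (?\<tau> \<circ> \<sigma>)) p = - (of_int (sign \<sigma>) * ren (?c \<circ> \<sigma>) p)"
      by (simp only: c) simp
  qed
  also have "\<dots> = - ren ?c ?N"
    by (simp add: ren_sum ren_mult ren_ren sum_negf)
  finally have "ren ?c ?N + ren ?c ?N = 0"
    by (simp only: eq_neg_iff_add_eq_0)
  then have "2 * ren ?c ?N = 0"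
    by (simp only: mult_2)
  then show "ren ?c ?N = 0"
    by simp
qed

subsection \<open>Fractions whose denominators are products of differences of variables\<close>

inductive_set diff_prods :: "'a::comm_ring_1 xt_poly set" where
  one: "1 \<in> diff_prods"
| mult: "i \<noteq> j \<Longrightarrow> d \<in> diff_prods \<Longrightarrow> (var_x i - var_x j) * d \<in> diff_prods"

lemma diff_prods_mult: "d \<in> diff_prods \<Longrightarrow> e \<in> diff_prods \<Longrightarrow> d * e \<in> diff_prods"
  by (induction rule: diff_prods.induct) (auto simp: mult.assoc intro: diff_prods.mult)

lemma diff_prods_neq_0: "d \<in> diff_prods \<Longrightarrow> d \<noteq> (0 :: 'a::idom xt_poly)"
  by (induction rule: diff_prods.induct) auto

text \<open>
  Identifying \<open>x\<^sub>i\<close> with \<open>x\<^sub>j\<close> does not affect \<open>v\<close>, so every \<open>x\<^sub>i - x\<^sub>j\<close> dividing \<open>v * q\<close>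
  divides \<open>q\<close>.
\<close>
lemma dvd_cancel_diff_prods:
  assumes "d \<in> diff_prods" "d * r = v * q" "v \<noteq> 0" "\<And>f. ren f v = v"
  shows "v dvd (r :: 'a::idom xt_poly)"
  using assms(1,2)
proof (induction arbitrary: q rule: diff_prods.induct)
  case (mult i j d)
  have "v * ren (collapse i j) q = ren (collapse i j) ((var_x i - var_x j) * d * r)"
    using mult.prems assms(4) by (simp add: ren_mult)
  also have "\<dots> = 0"
    by (simp add: ren_mult ren_diff collapse_def)
  finally have "var_x i - var_x j dvd q"
    using assms(3) by (intro ren_collapse_eq_0_imp_dvd) auto
  then obtain q' where "q = (var_x i - var_x j) * q'" by auto
  with mult.prems have "(var_x i - var_x j) * (d * r) = (var_x i - var_x j) * (v * q')"
    by (simp add: mult_ac)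
  moreover have "var_x i - var_x j \<noteq> (0 :: 'a xt_poly)"
    using mult.hyps by simp
  ultimately have "d * r = v * q'"
    using mult_left_cancel by blast
  then show ?case by (rule mult.IH)
qed simp

text \<open>The localisation of the polynomial ring at the multiplicative set
  \<open>diff_prods\<close>, inside the fraction field.\<close>

definition diff_fracts :: "'a::idom xt_poly fract set" where
  "diff_fracts = {to_fract p / to_fract d | p d. d \<in> diff_prods}"

lemma diff_fractsI: "d \<in> diff_prods \<Longrightarrow> to_fract p / to_fract d \<in> diff_fracts"
  by (auto simp: diff_fracts_def)

lemma to_fract_diff_fracts: "to_fract p \<in> diff_fracts"
  using diff_fractsI[OF diff_prods.one, of p] by simp

lemma diff_fracts_mult:
  assumes "f \<in> diff_fracts" "g \<in> diff_fracts"
  shows "f * g \<in> diff_fracts"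
proof -
  from assms obtain p d q e where "d \<in> diff_prods" "e \<in> diff_prods"
    "f = to_fract p / to_fract d" "g = to_fract q / to_fract e"
    by (auto simp: diff_fracts_def)
  then show ?thesis
    using diff_fractsI[OF diff_prods_mult, of d e "p * q"] by simp
qed

lemma diff_fracts_add:
  assumes "f \<in> diff_fracts" "g \<in> diff_fracts"
  shows "f + g \<in> diff_fracts"
proof -
  from assms obtain p d q e where "d \<in> diff_prods" "e \<in> diff_prods"
    "f = to_fract p / to_fract d" "g = to_fract q / to_fract e"
    by (auto simp: diff_fracts_def)
  then show ?thesis
    using diff_fractsI[OF diff_prods_mult, of d e "p * e + q * d"]
    by (simp add: diff_prods_neq_0 add_frac_eq)
qed

lemma diff_fracts_sum: "(\<And>i. i \<in> A \<Longrightarrow> f i \<in> diff_fracts) \<Longrightarrow> sum f A \<in> diff_fracts"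
  using to_fract_diff_fracts[of 0]
  by (induction A rule: infinite_finite_induct) (auto intro: diff_fracts_add)

lemma diff_fracts_prod: "(\<And>i. i \<in> A \<Longrightarrow> f i \<in> diff_fracts) \<Longrightarrow> prod f A \<in> diff_fracts"
  using to_fract_diff_fracts[of 1]
  by (induction A rule: infinite_finite_induct) (auto intro: diff_fracts_mult)

lemma diff_fracts_power: "f \<in> diff_fracts \<Longrightarrow> f ^ k \<in> diff_fracts"
  using to_fract_diff_fracts[of 1] by (induction k) (auto intro: diff_fracts_mult)

section \<open>Transfer to the fraction field of the polynomial ring\<close>

abbreviation xf :: "nat \<Rightarrow> 'a::idom xt_poly fract" where
  "xf i \<equiv> to_fract (var_x i)"

abbreviation tf :: "'a::idom xt_poly fract" where
  "tf \<equiv> to_fract var_t"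

lemma to_fract_power: "to_fract (p ^ k) = to_fract p ^ k"
  by (induction k) auto

lemma to_fract_prod: "to_fract (prod f A) = (\<Prod>i\<in>A. to_fract (f i))"
  by (induction A rule: infinite_finite_induct) auto

lemma to_fract_of_int: "to_fract (of_int k) = of_int k"
proof (cases k)
  have "to_fract (of_nat m) = of_nat m" for m
    by (induction m) auto
  then show "to_fract (of_int k) = of_int k" if "k = int m" for m
    using that by simp
  then show "to_fract (of_int k) = of_int k" if "k = - int (Suc m)" for m
    by (metis \<open>\<And>m. to_fract (of_nat m) = of_nat m\<close> of_int_minus of_int_of_nat_eq that to_fract_uminus)
qed

lemma to_fract_q_fact: "to_fract (q_fact var_t m) = q_fact tf m"
  by (simp add: q_fact_def q_int_def to_fract_prod to_fract_power)

lemma hl_factor_diff_fracts: "i \<noteq> j \<Longrightarrow> hl_factor xf tf i j \<in> diff_fracts"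
  using diff_fractsI[OF diff_prods.mult[OF _ diff_prods.one], of i j "var_x i - var_t * var_x j"]
  by (simp add: hl_factor_def)

text \<open>
  Grouping the summands by the set \<open>I\<close> of variables that receive the largest exponent, every
  sum over the orderings of \<open>I\<close> contributes the factor \<open>q_fact tf (card I)\<close>.
\<close>
lemma hl_sum_diff_fracts:
  assumes "finite S" "sorted_wrt (\<ge>) ls"
  shows "\<exists>q\<in>diff_fracts. hl_sum xf tf ls S =
    (\<Prod>c\<in>set ls. q_fact tf (count_list ls c)) * (q :: 'a::idom xt_poly fract)"
  using assms
proof (induction "length ls" arbitrary: ls S rule: less_induct)
  case less
  show ?case
  proof (cases ls)
    case Nil
    then show ?thesis using to_fract_diff_fracts[of 1] by auto
  next
    case (Cons c tail)
    \<comment> \<open>\<open>ls\<close> is the initial run of its largest part \<open>c\<close>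
      followed by \<open>ms\<close>; as \<open>ls\<close> is weakly decreasing, \<open>c\<close>
      does not return in \<open>ms\<close>.\<close>
    define ms where "ms = dropWhile (\<lambda>y. y = c) ls"
    define m where "m = length (takeWhile (\<lambda>y. y = c) ls)"
    have "takeWhile (\<lambda>y. y = c) ls = replicate m c"
      unfolding m_def by (rule replicate_length_same[symmetric]) (auto dest: set_takeWhileD)
    then have ls: "ls = replicate m c @ ms"
      using takeWhile_dropWhile_id[of "\<lambda>y. y = c" ls] by (simp add: ms_def)
    have "m > 0" by (simp add: m_def Cons)
    have sorted: "sorted_wrt (\<ge>) ms"
      using less.prems(2) unfolding ls sorted_wrt_append by blast
    have c: "c \<notin> set ms"
    proof
      assume "c \<in> set ms"
      then obtain y ys where ms: "ms = y # ys" by (cases ms) auto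
      then have "y \<noteq> c"
        using hd_dropWhile[of "\<lambda>y. y = c" ls] by (simp add: ms_def)
      moreover have "c \<ge> y"
        using less.prems(2) \<open>m > 0\<close> unfolding ls sorted_wrt_append by (simp add: ms)
      moreover have "y \<ge> c"
        using sorted \<open>c \<in> set ms\<close> \<open>y \<noteq> c\<close> by (auto simp: ms)
      ultimately show False by simp
    qed
    \<comment> \<open>The t-factorials of \<open>ms\<close> do not depend on the set
      \<open>T\<close> of remaining variables, so they come out of the sum over
      \<open>I\<close>.\<close>
    have "\<exists>q\<in>diff_fracts. hl_sum xf tf ms T =
        (\<Prod>c\<in>set ms. q_fact tf (count_list ms c)) * (q :: 'a xt_poly fract)" if "T \<subseteq> S" for T
      using that less.prems(1) \<open>m > 0\<close> sorted
      by (intro less.hyps) (auto simp: ls dest: finite_subset)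
    then obtain q :: "nat set \<Rightarrow> 'a xt_poly fract" where
      q: "\<And>T. T \<subseteq> S \<Longrightarrow> q T \<in> diff_fracts \<and>
        hl_sum xf tf ms T = (\<Prod>c\<in>set ms. q_fact tf (count_list ms c)) * q T"
      by metis
    define r where "r = (\<Sum>I | I \<subseteq> S \<and> card I = m.
      (\<Prod>i\<in>I. xf i ^ c * (\<Prod>j\<in>S - I. hl_factor xf tf i j)) * q (S - I))"
    have "r \<in> diff_fracts"
      unfolding r_def using q
      by (auto intro!: diff_fracts_sum diff_fracts_mult diff_fracts_prod diff_fracts_power
        hl_factor_diff_fracts to_fract_diff_fracts)
    have "var_t \<noteq> (1 :: 'a xt_poly)"
      using var_t_power_neq_1[of 1] by simp
    then have "tf \<noteq> (1 :: 'a xt_poly fract)"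
      by (metis to_fract_1 to_fract_eq_iff)
    then have "hl_sum xf tf ls S = q_fact tf m *
      (\<Sum>I | I \<subseteq> S \<and> card I = m. (\<Prod>i\<in>I. xf i ^ c * (\<Prod>j\<in>S - I. hl_factor xf tf i j)) *
        (hl_sum xf tf ms (S - I) :: 'a xt_poly fract))"
      unfolding ls using less.prems(1) by (intro hl_sum_block) (auto simp: inj_on_def)
    also have "\<dots> = q_fact tf m * ((\<Prod>c\<in>set ms. q_fact tf (count_list ms c)) * r)"
      by (simp add: q r_def sum_distrib_left mult_ac)
    also have "q_fact tf m * ((\<Prod>c\<in>set ms. q_fact tf (count_list ms c)) * r) =
        (\<Prod>c\<in>set ls. q_fact tf (count_list ls c)) * r"
    proof -
      have "count_list (replicate m c) b = (if b = c then m else 0)" for b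
        by (induction m) auto
      then have count: "count_list ls b = (if b = c then m else count_list ms b)" for b
        using c by (simp add: ls)
      have "set ls = insert c (set ms)"
        using \<open>m > 0\<close> by (auto simp: ls)
      moreover have "(\<Prod>b\<in>set ms. q_fact tf (count_list ls b)) =
          (\<Prod>b\<in>set ms. q_fact tf (count_list ms b) :: 'a xt_poly fract)"
        using c by (intro prod.cong) (auto simp: count)
      ultimately show ?thesis
        using c by (simp add: count mult.assoc)
    qed
    finally show ?thesis
      using \<open>r \<in> diff_fracts\<close> by blast
  qed
qed

subsection \<open>Hall--Littlewood polynomials are polynomials\<close>

text \<open>The inverse of the normalising factor of the Hall--Littlewood polynomial, as a
  polynomial in \<open>t\<close>.\<close>

definition hl_norm :: "nat \<Rightarrow> (nat \<Rightarrow> nat) \<Rightarrow> 'a::comm_ring_1 xt_poly" where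
  "hl_norm n lam = (\<Prod>c\<in>lam ` {1..n}. q_fact var_t (multiplicity_of_part n lam c))"

lemma hl_norm_neq_0: "hl_norm n lam \<noteq> (0 :: 'a::idom xt_poly)"
  by (simp add: hl_norm_def q_fact_var_t_neq_0)

lemma ren_hl_norm: "ren f (hl_norm n lam) = hl_norm n lam"
  by (simp add: hl_norm_def ren_prod)

text \<open>Each \<open>(1 - t) / (1 - t^j)\<close> is the inverse of a t-integer.\<close>

lemma hall_littlewood_fract_eq:
  "hall_littlewood_fract n lam = hl_sum xf tf (map lam [1..<Suc n]) {1..n} / to_fract (hl_norm n lam)"
proof -
  have factor: "Fract (1 - var_t) (1 - var_t ^ j) = inverse (to_fract (q_int (var_t :: 'a xt_poly) j))"
    if "j > 0" for j
  proof -
    define u where "u = 1 - (var_t :: 'a xt_poly)"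
    have "u \<noteq> 0"
      using var_t_power_neq_1[of 1] by (auto simp: u_def)
    moreover have "1 - var_t ^ j = u * q_int var_t j"
      by (simp add: u_def one_minus_var_t)
    ultimately show ?thesis
      by (simp add: Fract_conv_to_fract inverse_eq_divide flip: u_def)
  qed
  have "(\<Prod>i\<in>lam ` {1..n}. \<Prod>j=1..multiplicity_of_part n lam i. Fract (1 - var_t) (1 - var_t ^ j)) =
    (\<Prod>i\<in>lam ` {1..n}. \<Prod>j=1..multiplicity_of_part n lam i. inverse (to_fract (q_int (var_t :: 'a xt_poly) j)))"
    by (intro prod.cong refl factor) auto
  also have "\<dots> = inverse (to_fract (hl_norm n lam))"
    by (simp add: hl_norm_def q_fact_def to_fract_prod o_def flip: prod_inversef)
  finally show ?thesis
    unfolding hall_littlewood_fract_def sum_permutes_eq_hl_sum[symmetric]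
    by (simp add: Fract_conv_to_fract hl_factor_def to_fract_prod to_fract_power divide_inverse
        mult.commute case_prod_beta)
qed

lemma multiplicity_eq_count_list:
  "multiplicity_of_part n lam c = count_list (map lam [1..<Suc n]) c"
proof -
  have "count_list (map lam [1..<Suc n]) c = card (set (filter (\<lambda>i. c = lam i) [1..<Suc n]))"
    by (subst distinct_card) (simp_all add: count_list_eq_length_filter filter_map o_def del: upt_Suc)
  also have "set (filter (\<lambda>i. c = lam i) [1..<Suc n]) = {j \<in> {1..n}. lam j = c}"
    by (auto simp del: upt_Suc)
  finally show ?thesis
    by (simp add: multiplicity_of_part_def)
qed

text \<open>The summand of the identity permutation times the Vandermonde product, so not a single
  monomial in general.\<close>

definition hl_monomial :: "nat \<Rightarrow> (nat \<Rightarrow> nat) \<Rightarrow> 'a::comm_ring_1 xt_poly" where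
  "hl_monomial n lam = (\<Prod>i=1..n. var_x i ^ lam i) *
    (\<Prod>(i, j)\<in>index_pairs n. var_x i - var_t * var_x j)"

definition hl_numerator :: "nat \<Rightarrow> (nat \<Rightarrow> nat) \<Rightarrow> 'a::comm_ring_1 xt_poly" where
  "hl_numerator n lam = (\<Sum>\<sigma> | \<sigma> permutes {1..n}. of_int (sign \<sigma>) * ren \<sigma> (hl_monomial n lam))"

lemma ren_hl_monomial:
  "ren f (hl_monomial n lam) = (\<Prod>i=1..n. var_x (f i) ^ lam i) *
    (\<Prod>(i, j)\<in>index_pairs n. var_x (f i) - var_t * var_x (f j))"
  by (simp add: hl_monomial_def ren_mult ren_prod ren_power ren_diff case_prod_beta)

text \<open>The denominator of the summand of \<open>\<sigma>\<close> is the renamed Vandermonde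
  product, that is \<open>sign \<sigma>\<close> times the original. All summands thus share one
  denominator, and the signs move to the numerator.\<close>

lemma hl_sum_eq_hl_numerator:
  "hl_sum xf tf (map lam [1..<Suc n]) {1..n} =
    to_fract (hl_numerator n lam :: 'a::{idom,ring_char_0} xt_poly) / to_fract (vandermonde n)"
  unfolding hl_numerator_def to_fract_sum sum_divide_distrib sum_permutes_eq_hl_sum[symmetric]
proof (rule sum.cong[OF refl])
  fix \<sigma> assume "\<sigma> \<in> {\<sigma>. \<sigma> permutes {1..n}}"
  then have \<sigma>: "\<sigma> permutes {1..n}" by simp
  have sq: "(of_int (sign \<sigma>) * of_int (sign \<sigma>) :: 'a xt_poly fract) = 1"
    by (simp flip: of_int_mult)
  have "(\<Prod>(i, j)\<in>index_pairs n. hl_factor xf tf (\<sigma> i) (\<sigma> j)) =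
      to_fract (\<Prod>(i, j)\<in>index_pairs n. var_x (\<sigma> i) - var_t * var_x (\<sigma> j)) /
      to_fract (ren \<sigma> (vandermonde n :: 'a xt_poly))"
    by (simp add: vandermonde_def ren_prod ren_diff hl_factor_def to_fract_prod case_prod_beta prod_dividef)
  then have "(\<Prod>i=1..n. xf (\<sigma> i) ^ lam i) * (\<Prod>(i, j)\<in>index_pairs n. hl_factor xf tf (\<sigma> i) (\<sigma> j)) =
      to_fract (ren \<sigma> (hl_monomial n lam)) / (of_int (sign \<sigma>) * to_fract (vandermonde n :: 'a xt_poly))"
    by (simp add: ren_hl_monomial ren_permutes_vandermonde[OF \<sigma>] to_fract_prod to_fract_power
      to_fract_of_int)
  also have "\<dots> = of_int (sign \<sigma>) * to_fract (ren \<sigma> (hl_monomial n lam)) / to_fract (vandermonde n)"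
    by (cases \<sigma> rule: sign_cases) simp_all
  finally show "(\<Prod>i=1..n. xf (\<sigma> i) ^ lam i) *
      (\<Prod>(i, j)\<in>{(i, j). 1 \<le> i \<and> i < j \<and> j \<le> n}. hl_factor xf tf (\<sigma> i) (\<sigma> j)) =
      to_fract (of_int (sign \<sigma>) * ren \<sigma> (hl_monomial n lam)) / to_fract (vandermonde n :: 'a xt_poly)"
    by (simp only: to_fract_mult to_fract_of_int index_pairs_def)
qed

lemma ren_clamp_hl_numerator: "ren (clamp n) (hl_numerator n lam) = hl_numerator n lam"
  unfolding hl_numerator_def ren_sum
proof (rule sum.cong[OF refl])
  fix \<sigma> assume "\<sigma> \<in> {\<sigma>. \<sigma> permutes {1..n}}"
  then have "\<sigma> i \<in> {1..n}" if "i \<in> {1..n}" for i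
    using that permutes_in_image[of \<sigma> "{1..n}"] by blast
  then have c: "clamp n (\<sigma> i) = \<sigma> i" if "i \<in> {1..n}" for i
    using that by (simp add: clamp_def)
  have "ren (clamp n \<circ> \<sigma>) (hl_monomial n lam) = ren \<sigma> (hl_monomial n lam :: 'a xt_poly)"
    unfolding ren_hl_monomial
    by (intro arg_cong2[of _ _ _ _ "(*)"] prod.cong refl) (auto simp: c index_pairs_def)
  then show "ren (clamp n) (of_int (sign \<sigma>) * ren \<sigma> (hl_monomial n lam)) =
      of_int (sign \<sigma>) * ren \<sigma> (hl_monomial n lam :: 'a xt_poly)"
    by (simp add: ren_mult ren_ren)
qed

lemma ren_clamp_vandermonde: "ren (clamp n) (vandermonde n) = vandermonde n"
  unfolding vandermonde_def ren_prod_diff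
  by (intro prod.cong refl) (auto simp: clamp_def index_pairs_def)

lemma hall_littlewood_fract_polynomial:
  assumes "n \<ge> 1" "is_partition n lam"
  shows "\<exists>p\<in>polys_in n. hall_littlewood_fract n lam = to_fract (p :: 'a::{idom,ring_char_0} xt_poly)"
proof -
  define ls where "ls = map lam [1..<Suc n]"
  define F :: "'a xt_poly fract" where "F = hl_sum xf tf ls {1..n}"
  have "vandermonde n dvd (hl_numerator n lam :: 'a xt_poly)"
    unfolding hl_numerator_def by (rule vandermonde_dvd_antisymmetrization)
  then obtain R where R: "hl_numerator n lam = vandermonde n * (R :: 'a xt_poly)" by auto
  then have FR: "F = to_fract R"
    unfolding F_def ls_def hl_sum_eq_hl_numerator R by simp
  have "sorted_wrt (\<ge>) ls"
    using assms(2) unfolding ls_def is_partition_def sorted_wrt_map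
    by (auto simp: sorted_wrt_iff_nth_less monotone_on_def simp del: upt_Suc)
  then obtain q where q: "q \<in> diff_fracts"
    and "F = (\<Prod>c\<in>set ls. q_fact tf (count_list ls c)) * q"
    using hl_sum_diff_fracts[of "{1..n}" ls] unfolding F_def by auto
  moreover have "(\<Prod>c\<in>set ls. q_fact tf (count_list ls c)) = to_fract (hl_norm n lam :: 'a xt_poly)"
    by (simp add: hl_norm_def to_fract_prod to_fract_q_fact multiplicity_eq_count_list ls_def
      atLeastLessThanSuc_atLeastAtMost del: upt_Suc)
  ultimately have Fq: "F = to_fract (hl_norm n lam) * q" by simp
  from q obtain Q d where d: "d \<in> diff_prods" "q = to_fract Q / to_fract d"
    by (auto simp: diff_fracts_def)
  \<comment> \<open>\<open>F\<close> is both the polynomial \<open>R\<close> and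
    \<open>hl_norm n lam\<close> times a fraction over \<open>d\<close>. Clearing \<open>d\<close>
    gives an equation of polynomials, in which the differences can be cancelled.\<close>
  then have "to_fract (d * R) = to_fract (hl_norm n lam * Q)"
    using Fq FR diff_prods_neq_0[OF d(1)] by (simp add: field_simps)
  then have "d * R = hl_norm n lam * Q"
    by (simp only: to_fract_eq_iff)
  then have "hl_norm n lam dvd R"
    using d(1) by (intro dvd_cancel_diff_prods[of d R _ Q]) (simp_all add: hl_norm_neq_0 ren_hl_norm)
  then obtain P where P: "R = hl_norm n lam * P" by auto
  have eq: "vandermonde n * hl_norm n lam * P = hl_numerator n lam"
    by (simp add: R P mult_ac)
  \<comment> \<open>Numerator, Vandermonde product and norm are fixed by \<open>clamp n\<close>;
    cancelling shows that the quotient \<open>P\<close> is fixed too.\<close>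
  have "vandermonde n * hl_norm n lam * ren (clamp n) P = ren (clamp n) (vandermonde n * hl_norm n lam * P)"
    by (simp add: ren_mult ren_clamp_vandermonde ren_hl_norm)
  also have "\<dots> = vandermonde n * hl_norm n lam * P"
    unfolding eq by (rule ren_clamp_hl_numerator)
  finally have "ren (clamp n) P = P"
    by (simp add: hl_norm_neq_0)
  then have "P \<in> polys_in n"
    using assms(1) by (simp add: polys_in_iff_ren)
  moreover have "hall_littlewood_fract n lam = to_fract P"
    using FR by (simp add: hall_littlewood_fract_eq P hl_norm_neq_0 F_def ls_def del: upt_Suc)
  ultimately show ?thesis by blast
qed

text \<open>The description by \<open>THE\<close> has a solution by the previous result, and only
  one because \<open>to_fract\<close> is injective.\<close>

lemma to_fract_hall_littlewood:
  assumes "n \<ge> 1" "is_partition n lam"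
  shows "to_fract (hall_littlewood n lam :: 'a::{idom,ring_char_0} xt_poly) = hall_littlewood_fract n lam"
proof -
  obtain p :: "'a xt_poly" where "p \<in> polys_in n" "hall_littlewood_fract n lam = to_fract p"
    using hall_littlewood_fract_polynomial[OF assms] by blast
  then have "hall_littlewood n lam = p"
    unfolding hall_littlewood_def to_fract_def[symmetric] by auto
  then show ?thesis
    by (simp add: \<open>hall_littlewood_fract n lam = to_fract p\<close>)
qed

subsection \<open>The recurrence\<close>

text \<open>The \<open>c i\<close> are the coefficients, from the top, of the monic polynomial with
  roots \<open>y j\<close>. With \<open>f = clamp n\<close>, their invariance puts them in
  \<open>polys_in n\<close>.\<close>

lemma exists_common_recurrence:
  assumes "finite I" "\<And>j. j \<in> I \<Longrightarrow> ren f (y j) = (y j :: 'a::idom xt_poly)"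
  obtains c where "c 0 = 1" "\<And>i. ren f (c i) = c i"
    "\<And>j. j \<in> I \<Longrightarrow> (\<Sum>i\<le>card I. c i * y j ^ (card I - i)) = 0"
proof -
  define G where "G I = (\<Prod>j\<in>I. [:- y j, 1:])" for I
  have ren_coeff: "ren f (coeff (G I) i) = coeff (G I) i" for i
    using assms
  proof (induction I arbitrary: i rule: finite_induct)
    case (insert a I)
    then show ?case
      by (cases i) (simp_all add: G_def coeff_pCons ren_add ren_mult ren_uminus ren_diff)
  qed (simp add: G_def)
  have deg: "Polynomial.degree (G I) = card I"
    unfolding G_def by (subst degree_prod_eq_sum_degree) auto
  have "lead_coeff (G I) = 1"
    unfolding G_def by (subst lead_coeff_prod) auto
  then have "coeff (G I) (card I) = 1"
    by (simp add: deg)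
  moreover have "(\<Sum>i\<le>card I. coeff (G I) (card I - i) * y j ^ (card I - i)) = 0" if "j \<in> I" for j
  proof -
    have "(\<Sum>i\<le>card I. coeff (G I) (card I - i) * y j ^ (card I - i)) =
        (\<Sum>i\<le>card I. coeff (G I) i * y j ^ i)"
      by (rule sum.reindex_bij_witness[of _ "\<lambda>i. card I - i" "\<lambda>i. card I - i"]) auto
    also have "\<dots> = poly (G I) (y j)"
      by (simp add: poly_altdef deg)
    also have "\<dots> = 0"
      unfolding G_def poly_prod using assms(1) that by (intro prod_zero) auto
    finally show ?thesis .
  qed
  ultimately show ?thesis
    using ren_coeff by (intro that[of "\<lambda>i. coeff (G I) (card I - i)"]) auto
qed

text \<open>Multiplication by \<open>k \<ge> 1\<close> is injective on parts, so multiplicities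
  survive. At \<open>k = 0\<close> all parts would merge, so the common formula starts at
  \<open>k = 1\<close>.\<close>

lemma hl_norm_scale: "k \<ge> 1 \<Longrightarrow> hl_norm n (\<lambda>i. k * lam i) = hl_norm n lam"
proof -
  assume k: "k \<ge> 1"
  then have "multiplicity_of_part n (\<lambda>i. k * lam i) (k * c) = multiplicity_of_part n lam c" for c
    by (simp add: multiplicity_of_part_def)
  moreover have "(\<lambda>i. k * lam i) ` {1..n} = (*) k ` lam ` {1..n}"
    by (simp add: image_image)
  moreover have "inj_on ((*) k) (lam ` {1..n})"
    using k by (auto simp: inj_on_def)
  ultimately show ?thesis
    by (simp add: hl_norm_def prod.reindex del: One_nat_def)
qed

theorem mainTheorem4:
  fixes n :: nat and lam :: "nat \<Rightarrow> nat"
  assumes "n \<ge> 1" and "is_partition n lam"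
  shows "satisfies_linear_recurrence n
    (\<lambda>k. hall_littlewood n (\<lambda>i. k * lam i) :: 'a::{idom,ring_char_0} xt_poly)"
proof -
  define \<Sigma> where "\<Sigma> = {\<sigma>. \<sigma> permutes {1..n}}"
  have "finite \<Sigma>"
    unfolding \<Sigma>_def by (rule finite_permutations) simp
  \<comment> \<open>The order is \<open>n!\<close>: one root per permutation, repeated when several
    \<open>y \<sigma>\<close> coincide.\<close>
  define r where "r = card \<Sigma>"
  have "id \<in> \<Sigma>"
    by (simp add: \<Sigma>_def permutes_id del: One_nat_def)
  then have "r \<ge> 1"
    unfolding r_def using \<open>finite \<Sigma>\<close> by (auto simp: Suc_le_eq card_gt_0_iff)
  define y :: "(nat \<Rightarrow> nat) \<Rightarrow> 'a xt_poly" where "y \<sigma> = (\<Prod>i=1..n. var_x (\<sigma> i) ^ lam i)" for \<sigma>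
  have y: "ren (clamp n) (y \<sigma>) = y \<sigma>" if "\<sigma> \<in> \<Sigma>" for \<sigma>
  proof -
    have "clamp n (\<sigma> i) = \<sigma> i" if "i \<in> {1..n}" for i
      using \<open>\<sigma> \<in> \<Sigma>\<close> that permutes_in_image[of \<sigma> "{1..n}" i]
      by (simp add: \<Sigma>_def clamp_def)
    then show ?thesis
      unfolding y_def ren_prod ren_power ren_var_x by (intro prod.cong) auto
  qed
  obtain c where c0: "c 0 = 1" and c: "\<And>i. ren (clamp n) (c i) = c i"
    and rec: "\<And>\<sigma>. \<sigma> \<in> \<Sigma> \<Longrightarrow> (\<Sum>i\<le>r. c i * y \<sigma> ^ (r - i)) = 0"
    using exists_common_recurrence[of \<Sigma> "clamp n" y] \<open>finite \<Sigma>\<close> y unfolding r_def by blast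
  define a :: "nat \<Rightarrow> 'a xt_poly" where "a k = hall_littlewood n (\<lambda>i. k * lam i)" for k
  \<comment> \<open>The part of the summand of \<open>\<sigma>\<close> that is the same for all
    \<open>k \<ge> 1\<close>, by \<open>hl_norm_scale\<close>.\<close>
  define B :: "(nat \<Rightarrow> nat) \<Rightarrow> 'a xt_poly fract" where
    "B \<sigma> = (\<Prod>(i, j)\<in>{(i, j). 1 \<le> i \<and> i < j \<and> j \<le> n}. hl_factor xf tf (\<sigma> i) (\<sigma> j)) /
      to_fract (hl_norm n lam)" for \<sigma>
  have a: "to_fract (a k) = (\<Sum>\<sigma>\<in>\<Sigma>. B \<sigma> * to_fract (y \<sigma> ^ k))" if "k \<ge> 1" for k
  proof -
    have "is_partition n (\<lambda>i. k * lam i)"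
      using assms(2) by (simp add: is_partition_def monotone_on_def)
    then have "to_fract (a k) = hall_littlewood_fract n (\<lambda>i. k * lam i)"
      unfolding a_def by (rule to_fract_hall_littlewood[OF assms(1)])
    also have "\<dots> = (\<Sum>\<sigma>\<in>\<Sigma>. (\<Prod>i=1..n. xf (\<sigma> i) ^ (k * lam i)) *
      (\<Prod>(i, j)\<in>{(i, j). 1 \<le> i \<and> i < j \<and> j \<le> n}. hl_factor xf tf (\<sigma> i) (\<sigma> j))) /
      to_fract (hl_norm n lam)"
      unfolding hall_littlewood_fract_eq sum_permutes_eq_hl_sum[symmetric] hl_norm_scale[OF that] \<Sigma>_def ..
    also have "\<dots> = (\<Sum>\<sigma>\<in>\<Sigma>. B \<sigma> * to_fract (y \<sigma> ^ k))"
      unfolding sum_divide_distrib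
    proof (rule sum.cong[OF refl])
      fix \<sigma>
      have eq: "to_fract (y \<sigma> ^ k) = (\<Prod>i=1..n. xf (\<sigma> i) ^ (k * lam i))"
        by (simp only: y_def to_fract_power to_fract_prod prod_power_distrib power_mult[symmetric]
          mult.commute[of k])
      show "(\<Prod>i=1..n. xf (\<sigma> i) ^ (k * lam i)) *
        (\<Prod>(i, j)\<in>{(i, j). 1 \<le> i \<and> i < j \<and> j \<le> n}. hl_factor xf tf (\<sigma> i) (\<sigma> j)) /
        to_fract (hl_norm n lam) = B \<sigma> * to_fract (y \<sigma> ^ k)"
        unfolding eq B_def times_divide_eq_left by (simp only: mult.commute)
    qed
    finally show ?thesis .
  qed
  have "a k + (\<Sum>i=1..r. c i * a (k - i)) = 0" if k: "k \<ge> r + 1" for k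
  proof -
    have "{..r} = insert 0 {1..r}" by auto
    then have "a k + (\<Sum>i=1..r. c i * a (k - i)) = (\<Sum>i\<le>r. c i * a (k - i))"
      by (simp add: c0)
    also have "to_fract \<dots> = (\<Sum>i\<le>r. \<Sum>\<sigma>\<in>\<Sigma>. B \<sigma> * to_fract (c i * y \<sigma> ^ (k - i)))"
    proof -
      \<comment> \<open>From \<open>i \<le> r < k\<close> follows \<open>k - i \<ge> 1\<close>,
        where the closed form of \<open>a\<close> holds.\<close>
      have "to_fract (c i * a (k - i)) = (\<Sum>\<sigma>\<in>\<Sigma>. B \<sigma> * to_fract (c i * y \<sigma> ^ (k - i)))"
        if "i \<le> r" for i
        using a[of "k - i"] that k by (simp add: sum_distrib_left mult_ac)
      then show ?thesis
        unfolding to_fract_sum by (intro sum.cong) auto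
    qed
    also have "\<dots> = (\<Sum>\<sigma>\<in>\<Sigma>. B \<sigma> * to_fract (\<Sum>i\<le>r. c i * y \<sigma> ^ (k - i)))"
      by (subst sum.swap) (simp only: sum_distrib_left to_fract_sum)
    also have "\<dots> = 0"
    proof (rule sum.neutral, rule ballI)
      fix \<sigma> assume "\<sigma> \<in> \<Sigma>"
      \<comment> \<open>This is the characteristic equation of \<open>y \<sigma>\<close> multiplied
        by \<open>y \<sigma> ^ (k - r)\<close>.\<close>
      have "(\<Sum>i\<le>r. c i * y \<sigma> ^ (k - i)) = (\<Sum>i\<le>r. y \<sigma> ^ (k - r) * (c i * y \<sigma> ^ (r - i)))"
      proof (rule sum.cong[OF refl])
        fix i assume "i \<in> {..r}"
        then have "k - i = (k - r) + (r - i)"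
          using k by simp
        then show "c i * y \<sigma> ^ (k - i) = y \<sigma> ^ (k - r) * (c i * y \<sigma> ^ (r - i))"
          by (simp only: power_add mult_ac)
      qed
      also have "\<dots> = 0"
        using rec[OF \<open>\<sigma> \<in> \<Sigma>\<close>] by (simp flip: sum_distrib_left)
      finally show "B \<sigma> * to_fract (\<Sum>i\<le>r. c i * y \<sigma> ^ (k - i)) = 0"
        by simp
    qed
    finally show ?thesis
      by (simp only: to_fract_eq_0_iff)
  qed
  moreover have "c i \<in> polys_in n" for i
    using c assms(1) by (simp add: polys_in_iff_ren)
  ultimately show ?thesis
    unfolding satisfies_linear_recurrence_def a_def using \<open>r \<ge> 1\<close> by blast
qed

end
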